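(* Let $\mathcal{Y}$ be a finite set, $\mathcal{U}$ a Polish space, $\Theta\subseteq\mathbb{R}^{d_\theta}$ open, and $X$ a random element. For each value $x$ of $X$ let $P(\cdot\vert x)$ be a probability on $\mathcal{Y}$ (the conditional distribution of the outcome given $X=x$), and for each $\theta\in\Theta$ let $\nu(\cdot\vert x;\theta)$ be a probability measure on $\mathcal{U}$ and $\epsilon\mapsto G(\epsilon\vert x;\theta)\subseteq\mathcal{Y}$ a measurable correspondence. Put $\mathcal{L}(A\vert x;\theta)=\nu(\{\epsilon: G(\epsilon\vert x;\theta)\cap A\ne\varnothing\}\vert x;\theta)$ for $A\subseteq\mathcal{Y}$. Then for all $\theta\in\Theta$, $X$-almost surely, the set function $A\mapsto\mathcal{L}(A\vert X;\theta)-P(A\vert X)$, defined for all $A\subseteq\mathcal{Y}$, is submodular.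
   Context: Measurable correspondence: for almost all $x$ and all $\theta$, for every $A\subseteq\mathcal{Y}$ the set $\{\epsilon\in\mathcal{U}: G(\epsilon\vert x;\theta)\cap A\ne\varnothing\}$ is measurable. A set function $\varphi:2^{\mathcal{Y}}\to\mathbb{R}$ is submodular if $\varphi(A\cup B)+\varphi(A\cap B)\leq\varphi(A)+\varphi(B)$ for all $A,B\subseteq\mathcal{Y}$. *)

theory Defs
  imports "HOL-Probability.Probability"
begin

definition submodular_on :: "'y set \<Rightarrow> ('y set \<Rightarrow> real) \<Rightarrow> bool" where
  "submodular_on Y \<phi> \<longleftrightarrow>
     (\<forall>A B. A \<subseteq> Y \<longrightarrow> B \<subseteq> Y \<longrightarrow> \<phi> (A \<union> B) + \<phi> (A \<inter> B) \<le> \<phi> A + \<phi> B)"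

definition measurable_correspondence :: "'u measure \<Rightarrow> 'y set \<Rightarrow> ('u \<Rightarrow> 'y set) \<Rightarrow> bool" where
  "measurable_correspondence N Y \<Gamma> \<longleftrightarrow>
     (\<forall>A\<subseteq>Y. {\<epsilon> \<in> space N. \<Gamma> \<epsilon> \<inter> A \<noteq> {}} \<in> sets N)"

definition hitting_prob :: "'u measure \<Rightarrow> ('u \<Rightarrow> 'y set) \<Rightarrow> 'y set \<Rightarrow> real" where
  "hitting_prob N \<Gamma> A = measure N {\<epsilon> \<in> space N. \<Gamma> \<epsilon> \<inter> A \<noteq> {}}"

text \<open>Regular version of the conditional distribution of \<open>W\<close> (with values in \<open>MW\<close>) given
  \<open>X\<close> (with values in \<open>MX\<close>): a Markov kernel that disintegrates the joint law of \<open>X\<close> and \<open>W\<close>.\<close>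

definition cond_distribution ::
    "'w measure \<Rightarrow> 'x measure \<Rightarrow> 'y measure \<Rightarrow> ('w \<Rightarrow> 'x) \<Rightarrow> ('w \<Rightarrow> 'y) \<Rightarrow> ('x \<Rightarrow> 'y measure) \<Rightarrow> bool" where
  "cond_distribution M MX MW X W P \<longleftrightarrow>
     P \<in> MX \<rightarrow>\<^sub>M prob_algebra MW \<and>
     (\<forall>B\<in>sets MX. \<forall>A\<in>sets MW.
        measure M {\<omega> \<in> space M. X \<omega> \<in> B \<and> W \<omega> \<in> A} =
        (LINT x:B|distr M MX X. measure (P x) A))"

end

theory Submission
  imports Defs
begin

text \<open>Fix \<open>x\<close> and \<open>\<theta>\<close>. Passing from \<open>A\<close> to the
  event that the random set meets \<open>A\<close> carries unions to unions, but intersections only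
  into intersections: a set that meets \<open>A \<inter> B\<close> meets both \<open>A\<close> and
  \<open>B\<close>, not conversely. Since a finite measure is modular, the hitting probability is
  therefore submodular (\<open>submodular_on_hitting_prob\<close>). The conditional law
  \<open>P x\<close> is itself modular, so subtracting it preserves the inequality
  (\<open>submodular_on_diff_measure\<close>). The argument is pointwise in \<open>x\<close>; the
  null set comes only from the measurability of the correspondence.\<close>

lemma (in finite_measure) submodular_on_hitting_prob:
  assumes "measurable_correspondence M Y \<Gamma>"
  shows "submodular_on Y (hitting_prob M \<Gamma>)"
  unfolding submodular_on_def
proof (intro allI impI)
  fix A B assume AB: "A \<subseteq> Y" "B \<subseteq> Y"
  define H where "H A = {\<epsilon> \<in> space M. \<Gamma> \<epsilon> \<inter> A \<noteq> {}}" for A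
  have sets: "H C \<in> sets M" if "C \<subseteq> Y" for C
    using assms that by (simp add: measurable_correspondence_def H_def)
  have "measure M (H (A \<union> B)) + measure M (H (A \<inter> B))
      \<le> measure M (H A \<union> H B) + measure M (H A \<inter> H B)"
  proof (rule add_mono)
    have "H (A \<union> B) = H A \<union> H B"
      by (auto simp: H_def)
    then show "measure M (H (A \<union> B)) \<le> measure M (H A \<union> H B)"
      by simp
    \<comment> \<open>The only loss in the argument: \<open>\<Gamma> \<epsilon>\<close> may meet
      \<open>A\<close> and \<open>B\<close> at different points and miss
      \<open>A \<inter> B\<close>, so the inclusion of events can be strict.\<close>
    show "measure M (H (A \<inter> B)) \<le> measure M (H A \<inter> H B)"
      using sets AB by (intro finite_measure_mono) (auto simp: H_def)
  qed
  also have "\<dots> = measure M (H A) + measure M (H B)"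
    using measure_Un3[of "H A" M "H B"] sets AB by (simp add: fmeasurable_eq_sets)
  finally show "hitting_prob M \<Gamma> (A \<union> B) + hitting_prob M \<Gamma> (A \<inter> B)
      \<le> hitting_prob M \<Gamma> A + hitting_prob M \<Gamma> B"
    by (simp add: hitting_prob_def H_def)
qed

text \<open>By inclusion-exclusion, subtracting \<open>measure N\<close> lowers both sides of the
  submodular inequality by the same amount. Taking \<open>sets N = Pow Y\<close> makes this identity
  available for all subsets of \<open>Y\<close>.\<close>

lemma submodular_on_diff_measure:
  assumes "submodular_on Y \<phi>" "finite_measure N" "sets N = Pow Y"
  shows "submodular_on Y (\<lambda>A. \<phi> A - measure N A)"
  unfolding submodular_on_def
proof (intro allI impI)
  fix A B assume AB: "A \<subseteq> Y" "B \<subseteq> Y"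
  have "measure N (A \<union> B) = measure N A + measure N B - measure N (A \<inter> B)"
    using assms(2,3) AB by (intro measure_Un3) (auto simp: finite_measure.fmeasurable_eq_sets)
  moreover have "\<phi> (A \<union> B) + \<phi> (A \<inter> B) \<le> \<phi> A + \<phi> B"
    using assms(1) AB by (simp add: submodular_on_def)
  ultimately show "\<phi> (A \<union> B) - measure N (A \<union> B) + (\<phi> (A \<inter> B) - measure N (A \<inter> B))
      \<le> \<phi> A - measure N A + (\<phi> B - measure N B)"
    by linarith
qed

theorem lemma1:
  fixes M :: "'w measure" and MX :: "'x measure" and Y :: "'y set"
    and X :: "'w \<Rightarrow> 'x" and W :: "'w \<Rightarrow> 'y"
    and P :: "'x \<Rightarrow> 'y measure"
    and \<Theta> :: "(real ^ 'd) set"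
    and \<nu> :: "'x \<Rightarrow> real ^ 'd \<Rightarrow> ('u :: polish_space) measure"
    and G :: "'x \<Rightarrow> real ^ 'd \<Rightarrow> 'u \<Rightarrow> 'y set"
  assumes "prob_space M"
    and "finite Y"
    and "open \<Theta>"
    and "X \<in> M \<rightarrow>\<^sub>M MX"
    and "W \<in> M \<rightarrow>\<^sub>M count_space Y"
    and "cond_distribution M MX (count_space Y) X W P"
    and "\<And>x \<theta>. x \<in> space MX \<Longrightarrow> \<theta> \<in> \<Theta> \<Longrightarrow> prob_space (\<nu> x \<theta>)"
    and "\<And>x \<theta>. x \<in> space MX \<Longrightarrow> \<theta> \<in> \<Theta> \<Longrightarrow> sets (\<nu> x \<theta>) = sets borel"
    and "\<And>x \<theta> \<epsilon>. x \<in> space MX \<Longrightarrow> \<theta> \<in> \<Theta> \<Longrightarrow> G x \<theta> \<epsilon> \<subseteq> Y"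
    and "AE x in distr M MX X. \<forall>\<theta>\<in>\<Theta>. measurable_correspondence borel Y (G x \<theta>)"
  shows "\<forall>\<theta>\<in>\<Theta>. AE x in distr M MX X.
           submodular_on Y (\<lambda>A. hitting_prob (\<nu> x \<theta>) (G x \<theta>) A - measure (P x) A)"
proof
  fix \<theta> assume \<theta>: "\<theta> \<in> \<Theta>"
  have P: "P \<in> MX \<rightarrow>\<^sub>M prob_algebra (count_space Y)"
    using assms(6) by (simp add: cond_distribution_def)
  show "AE x in distr M MX X.
      submodular_on Y (\<lambda>A. hitting_prob (\<nu> x \<theta>) (G x \<theta>) A - measure (P x) A)"
    \<comment> \<open>The exceptional set is that of the measurability hypothesis;
      \<open>AE_space\<close> places \<open>x\<close> in \<open>space MX\<close>, where the kernel
      properties hold pointwise.\<close>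
    using assms(10) AE_space
  proof eventually_elim
    case (elim x)
    then have x: "x \<in> space MX"
      by simp
    interpret \<nu>: prob_space "\<nu> x \<theta>"
      using assms(7) x \<theta> .
    have "sets (\<nu> x \<theta>) = sets borel"
      using assms(8) x \<theta> .
    then have "measurable_correspondence (\<nu> x \<theta>) Y (G x \<theta>)"
      using elim(1) \<theta> sets_eq_imp_space_eq[of "\<nu> x \<theta>" borel]
      by (simp add: measurable_correspondence_def)
    then have "submodular_on Y (hitting_prob (\<nu> x \<theta>) (G x \<theta>))"
      by (rule \<nu>.submodular_on_hitting_prob)
    \<comment> \<open>A Markov kernel gives a probability on all subsets of \<open>Y\<close> at
      every such \<open>x\<close>, so no further null set arises.\<close>
    moreover have "P x \<in> space (prob_algebra (count_space Y))"
      using measurable_space[OF P x] .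
    then have "prob_space (P x)" "sets (P x) = Pow Y"
      by (simp_all add: space_prob_algebra)
    ultimately show ?case
      by (intro submodular_on_diff_measure) (simp_all add: prob_space.finite_measure)
  qed
qed

end
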